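(* Let $\alpha\in\mathbb{R}\setminus\{0,-1\}$. Suppose that one of the following holds: (i) $f\in L^{2}(\mathbb{R})$, $g\in L^{\infty}(\mathbb{R})$ and $x\in A^{2}_f\cap A^{\infty}_g$; or (ii) $f\in L^{p_1}(\mathbb{R})$, $g\in L^{p_2}(\mathbb{R})$ with $1<p_1,p_2<\infty$ and $\frac{1}{p_1}+\frac{1}{p_2}\le 1$, and $x\in A^{p_1}_f\cap A^{p_2}_g$. Then $$f(x)g(x)=\frac{i}{\pi}\Bigl(\lim_{\varepsilon\to 0^+}H_{\alpha,\varepsilon}(f,g)(x)-H_{\alpha}(f,g)(x)\Bigr),$$ where $$H_{\alpha,\varepsilon}(f,g)(x)=\int_{\mathbb{R}} f(x-t)\,g(x+\alpha t)\,\frac{dt}{t+i\varepsilon},\qquad \varepsilon\in(0,1).$$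
   Context: Functions are complex-valued measurable functions on $\mathbb{R}$, defined pointwise (a representative is fixed). $p$-Lebesgue points: for $1\le p<\infty$ and $f\in L^p_{loc}(\mathbb{R})$, a point $x\in\mathbb{R}$ is a $p$-Lebesgue point of $f$, written $x\in A^p_f$, if $\frac1r\int_{|t|<r}|f(x-t)-f(x)|^p\,dt\to 0$ as $r\to 0^+$. For $g\in L^\infty(\mathbb{R})$, $x\in A^\infty_g$ means $\operatorname{ess\,sup}_{|t|<r}|g(x-t)-g(x)|\to 0$ as $r\to 0^+$. The bilinear Hilbert transform is $$H_\alpha(f,g)(x)=\lim_{\varepsilon\to 0^+}\int_{|t|\ge\varepsilon} f(x-t)\,g(x+\alpha t)\,\frac{dt}{t}.$$ The claimed identity is understood at points $x$ where this limit, which defines $H_\alpha(f,g)(x)$, exists (and is finite); the existence of $\lim_{\varepsilon\to0^+}H_{\alpha,\varepsilon}(f,g)(x)$ is part of the conclusion. *)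

theory Defs
  imports "HOL-Analysis.Analysis" "HOL-Probability.Essential_Supremum"
begin

text \<open>
  The elements of these spaces are functions, not classes modulo equality almost everywhere:
  the value of a function at a single point matters for the notion of a Lebesgue point.
\<close>

definition Lp_space :: "real \<Rightarrow> (real \<Rightarrow> complex) set" where
  "Lp_space p = {f. f \<in> borel_measurable lebesgue \<and> integrable lebesgue (\<lambda>x. norm (f x) powr p)}"

definition Linf_space :: "(real \<Rightarrow> complex) set" where
  "Linf_space =
     {g. g \<in> borel_measurable lebesgue \<and> esssup lebesgue (\<lambda>x. ereal (norm (g x))) < \<infinity>}"

text \<open>
  Meaningful for \<open>f\<close> locally in \<open>L\<^sup>p\<close> with \<open>1 \<le> p\<close>; otherwise the Bochner integral
  may take its default value \<open>0\<close>.
\<close>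

definition Lebesgue_points :: "real \<Rightarrow> (real \<Rightarrow> complex) \<Rightarrow> real set" where
  "Lebesgue_points p f =
     {x. ((\<lambda>r. 1 / r * (LINT t:{t. \<bar>t\<bar> < r}|lebesgue. norm (f (x - t) - f x) powr p)) \<longlongrightarrow> 0)
           (at_right 0)}"

definition Lebesgue_points_inf :: "(real \<Rightarrow> complex) \<Rightarrow> real set" where
  "Lebesgue_points_inf g =
     {x. ((\<lambda>r. esssup (lebesgue_on {t. \<bar>t\<bar> < r}) (\<lambda>t. ereal (norm (g (x - t) - g x)))) \<longlongrightarrow> 0)
           (at_right (0 :: real))}"

definition bht_trunc ::
    "real \<Rightarrow> (real \<Rightarrow> complex) \<Rightarrow> (real \<Rightarrow> complex) \<Rightarrow> real \<Rightarrow> real \<Rightarrow> complex" where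
  "bht_trunc \<alpha> f g x \<epsilon> =
     (LINT t:{t. \<bar>t\<bar> \<ge> \<epsilon>}|lebesgue. f (x - t) * g (x + \<alpha> * t) / of_real t)"

definition bht_exists ::
    "real \<Rightarrow> (real \<Rightarrow> complex) \<Rightarrow> (real \<Rightarrow> complex) \<Rightarrow> real \<Rightarrow> bool" where
  "bht_exists \<alpha> f g x \<longleftrightarrow> (\<exists>h. (bht_trunc \<alpha> f g x \<longlongrightarrow> h) (at_right 0))"

text \<open>The value below is unspecified unless \<open>bht_exists \<alpha> f g x\<close> holds.\<close>

definition bht :: "real \<Rightarrow> (real \<Rightarrow> complex) \<Rightarrow> (real \<Rightarrow> complex) \<Rightarrow> real \<Rightarrow> complex" where
  "bht \<alpha> f g x = Lim (at_right 0) (bht_trunc \<alpha> f g x)"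

definition bht_reg ::
    "real \<Rightarrow> real \<Rightarrow> (real \<Rightarrow> complex) \<Rightarrow> (real \<Rightarrow> complex) \<Rightarrow> real \<Rightarrow> complex" where
  "bht_reg \<alpha> \<epsilon> f g x =
     (LINT t|lebesgue. f (x - t) * g (x + \<alpha> * t) / (of_real t + \<i> * of_real \<epsilon>))"

end

theory Submission
  imports Defs "HOL-Probability.Sinc_Integral"
begin

text \<open>
  Let \<open>F t = f (x - t) * g (x + \<alpha> * t)\<close>. The regularised and the truncated integral differ by the
  integral of \<open>F\<close> against the kernel \<open>1 / (t + \<i> \<epsilon>) - 1\<^bsub>\<bar>t\<bar> \<ge> \<epsilon>\<^esub> / t\<close>, which is dominated by twice the Poisson
  kernel \<open>\<epsilon> / (t\<^sup>2 + \<epsilon>\<^sup>2)\<close> and has total integral \<open>- \<i> \<pi>\<close>. Hence the difference tends to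
  \<open>- \<i> \<pi> f x g x\<close> as soon as \<open>0\<close> is a Lebesgue point of \<open>F\<close> and \<open>F t / (1 + \<bar>t\<bar>)\<close> is integrable.
  Both follow from Young's inequality in place of Hoelder's.
\<close>

text \<open>The limit is the Sokhotski-Plemelj formula 1/(t + i0) = p.v. 1/t - i \<pi> (Dirac mass
  at 0), tested at a Lebesgue point of \<open>F\<close> instead of against a smooth function. Two
  obstacles shape the proof. Both integrals are Bochner integrals, which default to 0 for a
  non-integrable integrand, so they may be subtracted only once each is known to converge
  absolutely; the weight \<open>1 / (1 + \<bar>t\<bar>)\<close> secures this, as \<open>F\<close>
  itself need not be integrable. And exponents with \<open>1 / p + 1 / q < 1\<close> do not fit
  Young's inequality, so one of them is lowered to the conjugate \<open>s\<close> of the other. The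
  loss is paid by an arbitrarily small constant in the averages near 0, and by
  \<open>(1 / (1 + \<bar>t\<bar>)) powr s\<close> at infinity, where constants are not integrable.
  Young's inequality is convenient because it holds pointwise and is simply integrated: no roots of
  integrals occur.\<close>

section \<open>The Poisson kernel: total mass and elementary bounds\<close>

lemma integrable_inverse_1_plus_square_lebesgue:
  "integrable lebesgue (\<lambda>x::real. inverse (1 + x\<^sup>2))"
  and integral_inverse_1_plus_square_lebesgue:
  "(LINT x|lebesgue. inverse (1 + x\<^sup>2)) = pi"
proof -
  have e: "einterval (-\<infinity>) \<infinity> = UNIV"
    by (auto simp: einterval_def)
  have 1: "integrable lborel (\<lambda>x::real. inverse (1 + x\<^sup>2))"
    using integrable_inverse_1_plus_square unfolding e by (simp add: set_integrable_def)
  then show "integrable lebesgue (\<lambda>x::real. inverse (1 + x\<^sup>2))"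
    by (simp add: integrable_completion)
  show "(LINT x|lebesgue. inverse (1 + x\<^sup>2)) = pi"
    using LBINT_inverse_1_plus_square 1
    by (simp add: interval_lebesgue_integral_def set_lebesgue_integral_def integral_completion e)
qed

lemma integrable_poisson:
  fixes \<epsilon> :: real
  assumes "\<epsilon> > 0"
  shows "integrable lebesgue (\<lambda>t. \<epsilon> / (t\<^sup>2 + \<epsilon>\<^sup>2))"
    and "(LINT t|lebesgue. \<epsilon> / (t\<^sup>2 + \<epsilon>\<^sup>2)) = pi"
proof -
  \<comment> \<open>The redundant \<open>0 +\<close> gives the argument the affine shape with which
    the substitution rules for Lebesgue integrals unify.\<close>
  have eq: "inverse (1 + (0 + (1 / \<epsilon>) * t)\<^sup>2) = \<epsilon> * (\<epsilon> / (t\<^sup>2 + \<epsilon>\<^sup>2))" for t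
    using assms by (simp add: field_simps power2_eq_square)
  have "integrable lebesgue (\<lambda>t. inverse (1 + (0 + (1 / \<epsilon>) * t)\<^sup>2))"
    by (rule lebesgue_integrable_real_affine[OF integrable_inverse_1_plus_square_lebesgue])
       (use assms in auto)
  then show "integrable lebesgue (\<lambda>t. \<epsilon> / (t\<^sup>2 + \<epsilon>\<^sup>2))"
    unfolding eq by (rule integrable_mult_left_iff[THEN iffD1, THEN disjE]) (use assms in auto)
  have "pi = \<bar>1 / \<epsilon>\<bar> *\<^sub>R (LINT t|lebesgue. inverse (1 + (0 + (1 / \<epsilon>) * t)\<^sup>2))"
    using lebesgue_integral_real_affine[of "1 / \<epsilon>" "\<lambda>x. inverse (1 + x\<^sup>2)" 0] assms
    by (simp add: integral_inverse_1_plus_square_lebesgue)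
  then show "(LINT t|lebesgue. \<epsilon> / (t\<^sup>2 + \<epsilon>\<^sup>2)) = pi"
    unfolding eq integral_mult_right_zero using assms by simp
qed

text \<open>The kernel peaks at \<open>t = 0\<close>. This bound serves the innermost interval of
  the dyadic decomposition; the bound by \<open>\<epsilon> / t\<^sup>2\<close> below serves the
  shells and the tail.\<close>

lemma poisson_le_inverse: "\<epsilon> > 0 \<Longrightarrow> \<epsilon> / (t\<^sup>2 + \<epsilon>\<^sup>2) \<le> 1 / (\<epsilon>::real)"
  using divide_left_mono[of "\<epsilon>\<^sup>2" "t\<^sup>2 + \<epsilon>\<^sup>2" \<epsilon>]
  by (simp add: add_nonneg_pos power2_eq_square)

lemma poisson_le_div_square: "\<epsilon> > 0 \<Longrightarrow> t \<noteq> 0 \<Longrightarrow> \<epsilon> / (t\<^sup>2 + \<epsilon>\<^sup>2) \<le> \<epsilon> / (t::real)\<^sup>2"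
  by (intro divide_left_mono mult_pos_pos add_nonneg_pos) auto

lemma measurable_abs_less_lebesgue [measurable]: "{t. \<bar>t\<bar> < (r::real)} \<in> sets lebesgue"
proof -
  have "{t. \<bar>t\<bar> < r} = {-r<..<r}" by auto
  then show ?thesis by simp
qed

lemma measurable_abs_ge_lebesgue [measurable]: "{t. \<bar>t\<bar> \<ge> (r::real)} \<in> sets lebesgue"
proof -
  have "{t. \<bar>t\<bar> \<ge> r} = {r..} \<union> {..-r}" by auto
  then show ?thesis by simp
qed

lemma integrable_dominated:
  fixes f :: "'a \<Rightarrow> 'b::{banach, second_countable_topology}"
  assumes "integrable M g" and "f \<in> borel_measurable M" and "\<And>x. norm (f x) \<le> g x"
  shows "integrable M f"
  by (rule Bochner_Integration.integrable_bound[OF assms(1,2)])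
     (use assms(3) in \<open>auto intro!: AE_I2 order_trans[OF _ abs_ge_self]\<close>)

lemma integrable_imp_set_integrable:
  fixes f :: "'a \<Rightarrow> 'b::{banach, second_countable_topology}"
  assumes "integrable M f" and "A \<in> sets M"
  shows "set_integrable M A f"
  unfolding set_integrable_def by (rule integrable_mult_indicator[OF assms(2,1)])

section \<open>Poisson integrals of nonnegative functions whose averages vanish at 0\<close>

text \<open>
  The constant adds up a contribution \<open>\<eta>\<close> of the innermost interval and \<open>2 * \<eta> / 2 ^ k\<close> of the dyadic
  shell \<open>2 ^ k * \<epsilon> \<le> \<bar>t\<bar> < 2 ^ (k + 1) * \<epsilon>\<close> for each \<open>k < n\<close>.
\<close>

lemma integral_poisson_dyadic_le:
  fixes G :: "real \<Rightarrow> real"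
  assumes pos: "\<And>t. 0 \<le> G t"
    and int: "\<And>r. set_integrable lebesgue {t. \<bar>t\<bar> < r} G"
    and intP: "integrable lebesgue (\<lambda>t. G t * (\<epsilon> / (t\<^sup>2 + \<epsilon>\<^sup>2)))"
    and le: "\<And>k. k \<le> n \<Longrightarrow> (LINT t:{t. \<bar>t\<bar> < 2 ^ k * \<epsilon>}|lebesgue. G t) \<le> \<eta> * (2 ^ k * \<epsilon>)"
    and "\<epsilon> > 0"
  shows "(LINT t:{t. \<bar>t\<bar> < 2 ^ n * \<epsilon>}|lebesgue. G t * (\<epsilon> / (t\<^sup>2 + \<epsilon>\<^sup>2))) \<le> \<eta> * (5 - 4 / 2 ^ n)"
  using le
proof (induction n)
  case 0
  have "(LINT t:{t. \<bar>t\<bar> < \<epsilon>}|lebesgue. G t * (\<epsilon> / (t\<^sup>2 + \<epsilon>\<^sup>2))) \<le> (LINT t:{t. \<bar>t\<bar> < \<epsilon>}|lebesgue. G t * (1 / \<epsilon>))"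
    using poisson_le_inverse[OF \<open>\<epsilon> > 0\<close>] pos
    by (intro set_integral_mono mult_left_mono set_integrable_mult_left int integrable_imp_set_integrable[OF intP]) auto
  also have "\<dots> = (1 / \<epsilon>) * (LINT t:{t. \<bar>t\<bar> < \<epsilon>}|lebesgue. G t)"
    by simp
  also have "\<dots> \<le> (1 / \<epsilon>) * (\<eta> * \<epsilon>)"
    using 0[of 0] \<open>\<epsilon> > 0\<close> by (intro mult_left_mono) auto
  finally show ?case using \<open>\<epsilon> > 0\<close> by simp
next
  case (Suc n)
  define P where "P t = G t * (\<epsilon> / (t\<^sup>2 + \<epsilon>\<^sup>2))" for t
  let ?A = "{t. \<bar>t\<bar> < 2 ^ n * \<epsilon>}" and ?B = "{t. \<bar>t\<bar> < 2 ^ Suc n * \<epsilon>}"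
  let ?D = "{t. \<bar>t\<bar> < 2 ^ Suc n * \<epsilon>} - {t. \<bar>t\<bar> < 2 ^ n * \<epsilon>}"
  have P: "set_integrable lebesgue S P" if "S \<in> sets lebesgue" for S
    unfolding P_def by (rule integrable_imp_set_integrable[OF intP that])
  have "2 ^ n * \<epsilon> \<le> 2 ^ Suc n * \<epsilon>" using \<open>\<epsilon> > 0\<close> by simp
  then have B: "?B = ?A \<union> ?D" by auto
  have "(LINT t:?B|lebesgue. P t) = (LINT t:?A|lebesgue. P t) + (LINT t:?D|lebesgue. P t)"
    by (subst B, rule set_integral_Un) (auto intro!: P)
  moreover have "(LINT t:?A|lebesgue. P t) \<le> \<eta> * (5 - 4 / 2 ^ n)"
    unfolding P_def using Suc by auto
  moreover have "(LINT t:?D|lebesgue. P t) \<le> \<eta> * (2 / 2 ^ n)"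
  proof -
    \<comment> \<open>The bound \<open>\<epsilon> / t\<^sup>2\<close> taken at the inner radius of
      the shell.\<close>
    let ?q = "\<epsilon> / (2 ^ n * \<epsilon>)\<^sup>2"
    \<comment> \<open>The hypothesis controls integrals of \<open>G\<close> over full intervals
      only, so the shell is enlarged to one, which costs nothing in sign because \<open>G\<close> is
      nonnegative.\<close>
    have "(LINT t:?D|lebesgue. P t) \<le> (LINT t:?B|lebesgue. G t * ?q)"
      unfolding set_lebesgue_integral_def
    proof (rule integral_mono)
      show "integrable lebesgue (\<lambda>x. indicat_real ?D x *\<^sub>R P x)"
        using P[of ?D] by (auto simp: set_integrable_def)
      show "integrable lebesgue (\<lambda>x. indicat_real ?B x *\<^sub>R (G x * ?q))"
        using int[of "2 ^ Suc n * \<epsilon>"] set_integrable_mult_left[of ?q lebesgue ?B G] by (auto simp: set_integrable_def)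
      fix t
      have "P t \<le> G t * ?q" if t: "t \<in> ?D"
      proof -
        have le: "2 ^ n * \<epsilon> \<le> \<bar>t\<bar>" and "t \<noteq> 0" using t \<open>\<epsilon> > 0\<close> by (auto simp: zero_less_mult_iff)
        have "(2 ^ n * \<epsilon>)\<^sup>2 \<le> t\<^sup>2" using power_mono[OF le, of 2] \<open>\<epsilon> > 0\<close> by simp
        then have "\<epsilon> / t\<^sup>2 \<le> ?q" using \<open>\<epsilon> > 0\<close> \<open>t \<noteq> 0\<close> by (intro divide_left_mono) auto
        then have "\<epsilon> / (t\<^sup>2 + \<epsilon>\<^sup>2) \<le> ?q"
          using poisson_le_div_square[OF \<open>\<epsilon> > 0\<close> \<open>t \<noteq> 0\<close>] by linarith
        then show ?thesis unfolding P_def using pos by (intro mult_left_mono) auto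
      qed
      then show "indicat_real ?D t *\<^sub>R P t \<le> indicat_real ?B t *\<^sub>R (G t * ?q)"
        using pos[of t] \<open>\<epsilon> > 0\<close> by (auto simp: indicator_def)
    qed
    also have "\<dots> = ?q * (LINT t:?B|lebesgue. G t)"
      by simp
    also have "\<dots> \<le> ?q * (\<eta> * (2 ^ Suc n * \<epsilon>))"
      using Suc.prems[of "Suc n"] \<open>\<epsilon> > 0\<close> by (intro mult_left_mono) auto
    also have "\<dots> = \<eta> * (2 / 2 ^ n)"
      using \<open>\<epsilon> > 0\<close> by (simp add: field_simps power2_eq_square)
    finally show ?thesis .
  qed
  ultimately have "(LINT t:?B|lebesgue. P t) \<le> \<eta> * (5 - 4 / 2 ^ n) + \<eta> * (2 / 2 ^ n)" by linarith
  also have "\<dots> = \<eta> * (5 - 4 / 2 ^ Suc n)" by (simp add: field_simps)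
  finally show ?case unfolding P_def .
qed

text \<open>The factor \<open>1 / \<epsilon>\<close> blows up, but the bound is used only to get
  integrability at each fixed \<open>\<epsilon>\<close>.\<close>

lemma poisson_le_inverse_1_plus_square:
  fixes \<epsilon> t :: real
  assumes "0 < \<epsilon>" "\<epsilon> \<le> 1"
  shows "\<epsilon> / (t\<^sup>2 + \<epsilon>\<^sup>2) \<le> (1 / \<epsilon>) * (1 / (1 + t\<^sup>2))"
proof -
  have "\<epsilon>\<^sup>2 * t\<^sup>2 \<le> 1 * t\<^sup>2"
    using assms by (intro mult_right_mono) (auto simp: power_le_one)
  then have "\<epsilon>\<^sup>2 * (1 + t\<^sup>2) \<le> t\<^sup>2 + \<epsilon>\<^sup>2"
    by (simp add: algebra_simps)
  moreover have "0 < t\<^sup>2 + \<epsilon>\<^sup>2" "0 < 1 + t\<^sup>2"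
    using assms by (auto intro: add_nonneg_pos add_pos_nonneg)
  ultimately have "\<epsilon> / (t\<^sup>2 + \<epsilon>\<^sup>2) \<le> \<epsilon> / (\<epsilon>\<^sup>2 * (1 + t\<^sup>2))"
    using assms by (intro divide_left_mono mult_pos_pos) auto
  then show ?thesis
    using assms by (simp add: power2_eq_square)
qed

text \<open>Away from 0 the kernel gains a factor \<open>\<epsilon>\<close> over the weight
  \<open>1 / (1 + t\<^sup>2)\<close>, uniformly in \<open>t\<close>; this makes the tail vanish in
  the limit.\<close>

lemma poisson_tail_le:
  fixes \<epsilon> \<delta> t :: real
  assumes "0 < \<epsilon>" "0 < \<delta>" "\<delta> \<le> \<bar>t\<bar>"
  shows "\<epsilon> / (t\<^sup>2 + \<epsilon>\<^sup>2) \<le> \<epsilon> * (1 + 1 / \<delta>\<^sup>2) * (1 / (1 + t\<^sup>2))"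
proof -
  have t: "t \<noteq> 0" using assms by auto
  have "\<delta>\<^sup>2 \<le> t\<^sup>2" using power_mono[OF assms(3), of 2] assms by simp
  then have "1 + t\<^sup>2 \<le> (1 + 1 / \<delta>\<^sup>2) * t\<^sup>2"
    using assms by (simp add: field_simps)
  moreover have "0 < 1 + t\<^sup>2" by (auto intro: add_pos_nonneg)
  ultimately have "1 / t\<^sup>2 \<le> (1 + 1 / \<delta>\<^sup>2) * (1 / (1 + t\<^sup>2))"
    using t by (simp add: field_simps)
  then have "\<epsilon> * (1 / t\<^sup>2) \<le> \<epsilon> * ((1 + 1 / \<delta>\<^sup>2) * (1 / (1 + t\<^sup>2)))"
    using assms by (intro mult_left_mono) auto
  then show ?thesis
    using poisson_le_div_square[OF \<open>0 < \<epsilon>\<close> t] by (simp add: mult.assoc)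
qed

text \<open>The lower bound lets the tail estimate apply outside the chosen radius, the upper bound
  keeps every smaller dyadic radius where the averages are controlled. The least \<open>n\<close>
  satisfying the first gives the second, because its predecessor fails.\<close>

lemma obtain_dyadic_scale:
  fixes \<epsilon> \<delta> :: real
  assumes "0 < \<epsilon>" "\<epsilon> < \<delta>"
  obtains n :: nat where "\<delta> \<le> 2 ^ n * \<epsilon>" "2 ^ n * \<epsilon> < 2 * \<delta>"
proof -
  define n where "n = (LEAST n::nat. \<delta> \<le> 2 ^ n * \<epsilon>)"
  obtain m :: nat where "\<delta> / \<epsilon> < 2 ^ m"
    using real_arch_pow[of 2 "\<delta> / \<epsilon>"] by auto
  then have "\<delta> \<le> 2 ^ m * \<epsilon>" using assms by (simp add: field_simps)
  then have n: "\<delta> \<le> 2 ^ n * \<epsilon>" unfolding n_def by (rule LeastI)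
  then obtain k where k: "n = Suc k" using assms by (cases n) auto
  then have "\<not> \<delta> \<le> 2 ^ k * \<epsilon>"
    using not_less_Least[of k "\<lambda>n. \<delta> \<le> 2 ^ n * \<epsilon>"] unfolding n_def by auto
  then show thesis using that[of n] n k by simp
qed

lemma set_integrable_of_weighted:
  fixes G :: "real \<Rightarrow> real"
  assumes pos: "\<And>t. 0 \<le> G t" and meas: "G \<in> borel_measurable lebesgue"
    and int: "integrable lebesgue (\<lambda>t. G t / (1 + t\<^sup>2))"
  shows "set_integrable lebesgue {t. \<bar>t\<bar> < r} G"
  unfolding set_integrable_def
proof (rule integrable_dominated)
  show "integrable lebesgue (\<lambda>t. (1 + r\<^sup>2) * (G t / (1 + t\<^sup>2)))"
    using int by (rule integrable_mult_right)
  show "(\<lambda>t. indicat_real {t. \<bar>t\<bar> < r} t *\<^sub>R G t) \<in> borel_measurable lebesgue"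
    using meas by measurable
  show "norm (indicat_real {t. \<bar>t\<bar> < r} t *\<^sub>R G t) \<le> (1 + r\<^sup>2) * (G t / (1 + t\<^sup>2))" for t
  proof (cases "\<bar>t\<bar> < r")
    case True
    then have "t\<^sup>2 \<le> r\<^sup>2" using power_mono[of "\<bar>t\<bar>" r 2] by simp
    then have "G t * (1 + t\<^sup>2) \<le> G t * (1 + r\<^sup>2)" using pos by (intro mult_left_mono) auto
    moreover have "0 < 1 + t\<^sup>2" by (auto intro: add_pos_nonneg)
    ultimately show ?thesis using True pos[of t]
      by (simp add: field_simps abs_mult)
  qed (use pos[of t] in auto)
qed

lemma integrable_mult_poisson:
  fixes G :: "real \<Rightarrow> real"
  assumes pos: "\<And>t. 0 \<le> G t" and meas[measurable]: "G \<in> borel_measurable lebesgue"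
    and int: "integrable lebesgue (\<lambda>t. G t / (1 + t\<^sup>2))" and "0 < \<epsilon>" "\<epsilon> \<le> 1"
  shows "integrable lebesgue (\<lambda>t. G t * (\<epsilon> / (t\<^sup>2 + \<epsilon>\<^sup>2)))"
proof (rule integrable_dominated)
  show "integrable lebesgue (\<lambda>t. (1 / \<epsilon>) * (G t / (1 + t\<^sup>2)))"
    using int by (rule integrable_mult_right)
  show "(\<lambda>t. G t * (\<epsilon> / (t\<^sup>2 + \<epsilon>\<^sup>2))) \<in> borel_measurable lebesgue"
    using integrable_poisson(1)[OF \<open>0 < \<epsilon>\<close>, THEN borel_measurable_integrable]
    by (intro borel_measurable_times meas)
  show "norm (G t * (\<epsilon> / (t\<^sup>2 + \<epsilon>\<^sup>2))) \<le> (1 / \<epsilon>) * (G t / (1 + t\<^sup>2))" for t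
    using mult_left_mono[OF poisson_le_inverse_1_plus_square[OF assms(4,5)] pos[of t], of t]
      pos[of t] \<open>0 < \<epsilon>\<close> by (simp add: abs_mult mult_ac)
qed

text \<open>The splitting radius \<open>2 ^ n * \<epsilon>\<close> varies with
  \<open>\<epsilon>\<close> but stays between \<open>\<delta>\<close> and
  \<open>2 * \<delta>\<close>, so \<open>\<delta>\<close> and the tail constant \<open>C\<close> are
  fixed before \<open>\<epsilon>\<close>. Inside, the dyadic estimate turns small averages into a
  small integral; outside, the bound is \<open>\<epsilon> * C\<close>.\<close>

lemma poisson_integral_tendsto_0:
  fixes G :: "real \<Rightarrow> real"
  assumes pos: "\<And>t. 0 \<le> G t" and meas[measurable]: "G \<in> borel_measurable lebesgue"
    and int: "integrable lebesgue (\<lambda>t. G t / (1 + t\<^sup>2))"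
    and avg: "((\<lambda>r. 1 / r * (LINT t:{t. \<bar>t\<bar> < r}|lebesgue. G t)) \<longlongrightarrow> 0) (at_right 0)"
  shows "((\<lambda>\<epsilon>. LINT t|lebesgue. G t * (\<epsilon> / (t\<^sup>2 + \<epsilon>\<^sup>2))) \<longlongrightarrow> 0) (at_right 0)"
proof (rule tendstoI)
  fix e :: real
  assume "e > 0"
  \<comment> \<open>With \<open>e / 20\<close> the near part is at most
    \<open>5 * \<eta> = e / 4\<close>; the far part takes up to \<open>e / 2\<close>.\<close>
  define \<eta> where "\<eta> = e / 20"
  have "\<eta> > 0" using \<open>e > 0\<close> by (simp add: \<eta>_def)
  from tendstoD[OF avg this] obtain b where "b > 0"
    and b: "\<And>r. 0 < r \<Longrightarrow> r < b \<Longrightarrow> dist (1 / r * (LINT t:{t. \<bar>t\<bar> < r}|lebesgue. G t)) 0 < \<eta>"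
    unfolding eventually_at_right_field by auto
  have le: "(LINT t:{t. \<bar>t\<bar> < r}|lebesgue. G t) \<le> \<eta> * r" if "0 < r" "r < b" for r
  proof -
    have "1 / r * (LINT t:{t. \<bar>t\<bar> < r}|lebesgue. G t) < \<eta>"
      using b[OF that] unfolding dist_real_def by linarith
    then show ?thesis using that by (simp add: field_simps)
  qed
  \<comment> \<open>Half of \<open>b\<close>, since the dyadic radii may come arbitrarily close to
    \<open>2 * \<delta>\<close>.\<close>
  define \<delta> where "\<delta> = b / 2"
  have "\<delta> > 0" using \<open>b > 0\<close> by (simp add: \<delta>_def)
  define C where "C = (1 + 1 / \<delta>\<^sup>2) * (LINT t|lebesgue. G t / (1 + t\<^sup>2))"
  have "((\<lambda>\<epsilon>. \<epsilon> * C) \<longlongrightarrow> 0 * C) (at_right 0)"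
    by (intro tendsto_intros)
  then have ev: "\<forall>\<^sub>F \<epsilon> in at_right 0. \<epsilon> * C < e / 2"
    using \<open>e > 0\<close> by (intro order_tendstoD) auto
  have "\<forall>\<^sub>F \<epsilon> in at_right 0. \<epsilon> < min 1 \<delta>"
    using \<open>\<delta> > 0\<close> by (intro eventually_at_rightI[of 0 "min 1 \<delta>"]) auto
  with ev eventually_at_right_less[of 0]
  show "\<forall>\<^sub>F \<epsilon> in at_right 0. dist (LINT t|lebesgue. G t * (\<epsilon> / (t\<^sup>2 + \<epsilon>\<^sup>2))) 0 < e"
  proof eventually_elim
    case (elim \<epsilon>)
    define P where "P t = G t * (\<epsilon> / (t\<^sup>2 + \<epsilon>\<^sup>2))" for t
    have P: "integrable lebesgue P"
      unfolding P_def by (rule integrable_mult_poisson[OF pos meas int]) (use elim in auto)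
    obtain n :: nat where n: "\<delta> \<le> 2 ^ n * \<epsilon>" "2 ^ n * \<epsilon> < 2 * \<delta>"
      using obtain_dyadic_scale[of \<epsilon> \<delta>] elim by auto
    let ?A = "{t. \<bar>t\<bar> < 2 ^ n * \<epsilon>}"
    have near: "(LINT t:?A|lebesgue. P t) \<le> \<eta> * (5 - 4 / 2 ^ n)"
      unfolding P_def
    proof (rule integral_poisson_dyadic_le)
      fix k assume "k \<le> n"
      then have "2 ^ k * \<epsilon> \<le> 2 ^ n * \<epsilon>" using elim by simp
      then have "2 ^ k * \<epsilon> < b" using n \<delta>_def by simp
      then show "(LINT t:{t. \<bar>t\<bar> < 2 ^ k * \<epsilon>}|lebesgue. G t) \<le> \<eta> * (2 ^ k * \<epsilon>)"
        using elim by (intro le) auto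
    qed (use P[unfolded P_def] pos set_integrable_of_weighted[OF pos meas int] elim in auto)
    have far: "(LINT t:-?A|lebesgue. P t) \<le> \<epsilon> * C"
    proof -
      have "(LINT t:-?A|lebesgue. P t) \<le> (LINT t|lebesgue. \<epsilon> * (1 + 1 / \<delta>\<^sup>2) * (G t / (1 + t\<^sup>2)))"
        unfolding set_lebesgue_integral_def
      proof (rule integral_mono)
        show "integrable lebesgue (\<lambda>t. indicat_real (-?A) t *\<^sub>R P t)"
          by (intro integrable_mult_indicator P) auto
        show "integrable lebesgue (\<lambda>t. \<epsilon> * (1 + 1 / \<delta>\<^sup>2) * (G t / (1 + t\<^sup>2)))"
          by (rule integrable_mult_right[OF int])
        fix t
        have nn: "0 \<le> \<epsilon> * (1 + 1 / \<delta>\<^sup>2) * (G t / (1 + t\<^sup>2))"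
          using elim pos by (intro mult_nonneg_nonneg divide_nonneg_nonneg add_nonneg_nonneg) auto
        show "indicat_real (-?A) t *\<^sub>R P t \<le> \<epsilon> * (1 + 1 / \<delta>\<^sup>2) * (G t / (1 + t\<^sup>2))"
        proof (cases "t \<in> ?A")
          case False
          then have "\<delta> \<le> \<bar>t\<bar>" using n by auto
          from mult_left_mono[OF poisson_tail_le[OF _ \<open>\<delta> > 0\<close> this, of \<epsilon>] pos[of t]]
          show ?thesis using False elim by (simp add: P_def mult_ac)
        qed (use nn in simp)
      qed
      then show ?thesis unfolding integral_mult_right_zero by (simp add: C_def mult.assoc)
    qed
    have "(LINT t|lebesgue. P t) = (LINT t:?A|lebesgue. P t) + (LINT t:-?A|lebesgue. P t)"
    proof -
      have "(LINT t|lebesgue. P t) = (LINT t:(?A \<union> -?A)|lebesgue. P t)"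
        by (simp add: set_lebesgue_integral_def)
      also have "\<dots> = (LINT t:?A|lebesgue. P t) + (LINT t:-?A|lebesgue. P t)"
        by (rule set_integral_Un) (auto intro!: integrable_imp_set_integrable P)
      finally show ?thesis .
    qed
    also have "\<dots> \<le> \<eta> * (5 - 4 / 2 ^ n) + \<epsilon> * C" using near far by simp
    also have "\<dots> \<le> \<eta> * 5 + \<epsilon> * C" using \<open>\<eta> > 0\<close> by simp
    also have "\<dots> < e" using elim \<open>e > 0\<close> by (simp add: \<eta>_def)
    finally have "(LINT t|lebesgue. P t) < e" .
    moreover have "0 \<le> (LINT t|lebesgue. P t)"
      using pos elim by (intro Bochner_Integration.integral_nonneg) (auto simp: P_def)
    ultimately show ?case by (simp add: dist_real_def P_def)
  qed
qed

section \<open>The kernel of the difference and its limit\<close>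

text \<open>Both summands decay only like \<open>1 / \<bar>t\<bar>\<close> and are not integrable
  over the line. Their difference decays like \<open>\<epsilon> / t\<^sup>2\<close>, so the two are
  kept together in one kernel.\<close>

definition bht_kernel :: "real \<Rightarrow> real \<Rightarrow> complex" where
  "bht_kernel \<epsilon> t = 1 / (of_real t + \<i> * of_real \<epsilon>) - (if \<epsilon> \<le> \<bar>t\<bar> then 1 / of_real t else 0)"

lemma norm_add_i_mult: "norm (of_real t + \<i> * of_real \<epsilon>) = sqrt (t\<^sup>2 + \<epsilon>\<^sup>2)"
  by (simp add: cmod_def)

lemma add_i_mult_neq_0: "\<epsilon> \<noteq> 0 \<Longrightarrow> of_real t + \<i> * of_real \<epsilon> \<noteq> (0::complex)"
  by (simp add: complex_eq_iff)

text \<open>The constant 2 comes from \<open>s \<le> \<bar>t\<bar> + \<epsilon>\<close>. If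
  \<open>\<epsilon> \<le> \<bar>t\<bar>\<close>, the kernel has norm
  \<open>\<epsilon> / (\<bar>t\<bar> * s)\<close> and \<open>s \<le> 2 * \<bar>t\<bar>\<close>;
  otherwise it has norm \<open>1 / s\<close> and \<open>s \<le> 2 * \<epsilon>\<close>.\<close>

lemma norm_bht_kernel_le:
  assumes "0 < \<epsilon>"
  shows "norm (bht_kernel \<epsilon> t) \<le> 2 * (\<epsilon> / (t\<^sup>2 + \<epsilon>\<^sup>2))"
proof -
  define s where "s = sqrt (t\<^sup>2 + \<epsilon>\<^sup>2)"
  have s2: "s * s = t\<^sup>2 + \<epsilon>\<^sup>2" by (simp add: s_def)
  have "0 < t\<^sup>2 + \<epsilon>\<^sup>2" using assms by (intro add_nonneg_pos) auto
  then have "0 < s" by (simp add: s_def)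
  have n: "norm (of_real t + \<i> * of_real \<epsilon>) = s" by (simp add: norm_add_i_mult s_def)
  have le: "s \<le> \<bar>t\<bar> + \<epsilon>" using sqrt_sum_squares_le_sum_abs[of t \<epsilon>] assms by (simp add: s_def)
  show ?thesis
  proof (cases "\<epsilon> \<le> \<bar>t\<bar>")
    case True
    then have t: "t \<noteq> 0" using assms by auto
    have "bht_kernel \<epsilon> t = - (\<i> * of_real \<epsilon>) / (of_real t * (of_real t + \<i> * of_real \<epsilon>))"
      using True t add_i_mult_neq_0[of \<epsilon> t] assms by (simp add: bht_kernel_def divide_simps)
    then have "norm (bht_kernel \<epsilon> t) = \<epsilon> / (\<bar>t\<bar> * s)"
      using assms by (simp add: norm_divide norm_mult n)
    also have "\<dots> \<le> 2 * (\<epsilon> / (s * s))"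
      using True t assms \<open>0 < s\<close> le by (simp add: divide_simps)
    finally show ?thesis by (simp add: s2)
  next
    case False
    then have "norm (bht_kernel \<epsilon> t) = 1 / s" by (simp add: bht_kernel_def norm_divide n)
    also have "\<dots> \<le> 2 * (\<epsilon> / (s * s))"
      using False assms \<open>0 < s\<close> le by (simp add: divide_simps)
    finally show ?thesis by (simp add: s2)
  qed
qed

lemma continuous_imp_borel_measurable_lebesgue:
  fixes f :: "real \<Rightarrow> 'a::euclidean_space"
  shows "continuous_on UNIV f \<Longrightarrow> f \<in> borel_measurable lebesgue"
  by (intro measurable_completion) (simp add: borel_measurable_continuous_onI)

lemma borel_measurable_of_real_lebesgue [measurable]:
  "(\<lambda>t. of_real t :: complex) \<in> borel_measurable lebesgue"
  by (intro continuous_imp_borel_measurable_lebesgue continuous_intros)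

lemma borel_measurable_ident_lebesgue [measurable]:
  "(\<lambda>t::real. t) \<in> borel_measurable lebesgue"
  by (intro continuous_imp_borel_measurable_lebesgue continuous_intros)

lemma measurable_bht_kernel [measurable]: "bht_kernel \<epsilon> \<in> borel_measurable lebesgue"
  unfolding bht_kernel_def by measurable

lemma integrable_bht_kernel:
  assumes "0 < \<epsilon>"
  shows "integrable lebesgue (bht_kernel \<epsilon>)"
proof (rule integrable_dominated)
  show "integrable lebesgue (\<lambda>t. 2 * (\<epsilon> / (t\<^sup>2 + \<epsilon>\<^sup>2)))"
    by (rule integrable_mult_right[OF integrable_poisson(1)[OF assms]])
qed (measurable, rule norm_bht_kernel_le[OF assms])

text \<open>The real part of the kernel is odd, and its imaginary part is minus the Poisson kernel.\<close>

lemma integral_bht_kernel: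
  assumes "0 < \<epsilon>"
  shows "(LINT t|lebesgue. bht_kernel \<epsilon> t) = - \<i> * of_real pi"
proof -
  let ?I = "LINT t|lebesgue. bht_kernel \<epsilon> t"
  have sum: "bht_kernel \<epsilon> t + bht_kernel \<epsilon> (- t) = - 2 * \<i> * of_real (\<epsilon> / (t\<^sup>2 + \<epsilon>\<^sup>2))" for t
  proof -
    have *: "1 / (of_real t + \<i> * of_real \<epsilon>) = cnj (of_real t + \<i> * of_real \<epsilon>) / of_real (t\<^sup>2 + \<epsilon>\<^sup>2)" for t
      by (subst complex_div_cnj) (simp add: norm_add_i_mult)
    show ?thesis
      unfolding bht_kernel_def * by (simp add: diff_divide_distrib minus_divide_left[symmetric])
  qed
  have refl: "integrable lebesgue (\<lambda>t. bht_kernel \<epsilon> (0 + (-1) * t))"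
    by (rule lebesgue_integrable_real_affine[OF integrable_bht_kernel[OF assms]]) auto
  have "?I = (LINT t|lebesgue. bht_kernel \<epsilon> (0 + (-1) * t))"
    using lebesgue_integral_real_affine[of "-1" "bht_kernel \<epsilon>" 0] by simp
  \<comment> \<open>Adding the reflected integral cancels the odd real part pointwise, so no
    separate treatment of real and imaginary parts is needed.\<close>
  then have "?I + ?I = (LINT t|lebesgue. bht_kernel \<epsilon> t + bht_kernel \<epsilon> (0 + (-1) * t))"
    using Bochner_Integration.integral_add[OF integrable_bht_kernel[OF assms] refl] by simp
  also have "\<dots> = (LINT t|lebesgue. - 2 * \<i> * of_real (\<epsilon> / (t\<^sup>2 + \<epsilon>\<^sup>2)))"
    using sum by simp
  also have "\<dots> = - 2 * \<i> * of_real (LINT t|lebesgue. \<epsilon> / (t\<^sup>2 + \<epsilon>\<^sup>2))"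
    by (simp only: integral_mult_right_zero integral_complex_of_real)
  finally show ?thesis
    using integrable_poisson(2)[OF assms] by simp
qed

text \<open>Constants can be integrated against the kernel difference, though not against its two
  summands, so \<open>c\<close> is split off there. Its share is exactly
  \<open>- \<i> * pi * c\<close> for every \<open>\<epsilon>\<close>, with no limit involved, and
  the remainder \<open>K \<epsilon>\<close> is at most twice the Poisson integral of
  \<open>norm (F t - c)\<close>.\<close>

lemma bht_reg_diff_trunc_tendsto:
  fixes F :: "real \<Rightarrow> complex"
  assumes meas[measurable]: "F \<in> borel_measurable lebesgue"
    and int: "integrable lebesgue (\<lambda>t. norm (F t) / (1 + \<bar>t\<bar>))"
    and avg: "((\<lambda>r. 1 / r * (LINT t:{t. \<bar>t\<bar> < r}|lebesgue. norm (F t - c))) \<longlongrightarrow> 0) (at_right 0)"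
  shows "((\<lambda>\<epsilon>. (LINT t|lebesgue. F t / (of_real t + \<i> * of_real \<epsilon>))
            - (LINT t:{t. \<bar>t\<bar> \<ge> \<epsilon>}|lebesgue. F t / of_real t)) \<longlongrightarrow> - \<i> * of_real pi * c) (at_right 0)"
proof -
  define G where "G t = norm (F t - c)" for t
  have Gm[measurable]: "G \<in> borel_measurable lebesgue" unfolding G_def by measurable
  have G0: "0 \<le> G t" for t by (simp add: G_def)
  have sq: "1 / (1 + t\<^sup>2) \<le> 2 * (1 / (1 + \<bar>t\<bar>))" for t :: real
  proof -
    have "0 \<le> (1 - \<bar>t\<bar>)\<^sup>2" by simp
    then have "2 * \<bar>t\<bar> \<le> 1 + t\<^sup>2" by (simp add: power2_eq_square algebra_simps)
    then have "1 + \<bar>t\<bar> \<le> 2 * (1 + t\<^sup>2)" by (simp add: abs_if) (smt (verit) zero_le_power2)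
    moreover have "0 < 1 + t\<^sup>2" by (auto intro: add_pos_nonneg)
    ultimately show ?thesis by (simp add: field_simps)
  qed
  \<comment> \<open>A nonzero constant is not integrable against
    \<open>1 / (1 + \<bar>t\<bar>)\<close>; after subtracting \<open>c\<close>, the integrable
    weight \<open>1 / (1 + t\<^sup>2)\<close> takes over.\<close>
  have "integrable lebesgue (\<lambda>t. 2 * (norm (F t) / (1 + \<bar>t\<bar>)) + norm c * inverse (1 + t\<^sup>2))"
    by (intro Bochner_Integration.integrable_add integrable_mult_right int
        integrable_inverse_1_plus_square_lebesgue)
  then have Gint: "integrable lebesgue (\<lambda>t. G t / (1 + t\<^sup>2))"
  proof (rule integrable_dominated)
    have "G t / (1 + t\<^sup>2) \<le> 2 * (norm (F t) / (1 + \<bar>t\<bar>)) + norm c * inverse (1 + t\<^sup>2)" for t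
    proof -
      have "G t / (1 + t\<^sup>2) \<le> (norm (F t) + norm c) / (1 + t\<^sup>2)"
        by (intro divide_right_mono) (auto simp: G_def norm_triangle_ineq4)
      also have "\<dots> = norm (F t) * (1 / (1 + t\<^sup>2)) + norm c * inverse (1 + t\<^sup>2)"
        by (simp add: divide_inverse distrib_right)
      also have "norm (F t) * (1 / (1 + t\<^sup>2)) \<le> norm (F t) * (2 * (1 / (1 + \<bar>t\<bar>)))"
        by (rule mult_left_mono[OF sq]) simp
      finally show ?thesis by (simp add: mult_ac)
    qed
    moreover have "0 \<le> G t / (1 + t\<^sup>2)" for t
      using G0 by (intro divide_nonneg_nonneg) auto
    ultimately show "norm (G t / (1 + t\<^sup>2)) \<le> 2 * (norm (F t) / (1 + \<bar>t\<bar>)) + norm c * inverse (1 + t\<^sup>2)" for t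
      by (metis abs_of_nonneg real_norm_def)
  qed measurable
  have lim: "((\<lambda>\<epsilon>. LINT t|lebesgue. G t * (\<epsilon> / (t\<^sup>2 + \<epsilon>\<^sup>2))) \<longlongrightarrow> 0) (at_right 0)"
    using poisson_integral_tendsto_0[OF G0 Gm Gint] avg by (simp add: G_def)
  define K where "K \<epsilon> = (LINT t|lebesgue. (F t - c) * bht_kernel \<epsilon> t)" for \<epsilon>
  have small: "\<forall>\<^sub>F \<epsilon>::real in at_right 0. 0 < \<epsilon> \<and> \<epsilon> \<le> 1"
    by (rule eventually_at_rightI[of 0 1]) auto
  have ev: "\<forall>\<^sub>F \<epsilon> in at_right 0. norm (K \<epsilon>) \<le> 2 * (LINT t|lebesgue. G t * (\<epsilon> / (t\<^sup>2 + \<epsilon>\<^sup>2))) \<and>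
      K \<epsilon> + c * (- \<i> * of_real pi) =
        (LINT t|lebesgue. F t / (of_real t + \<i> * of_real \<epsilon>))
            - (LINT t:{t. \<bar>t\<bar> \<ge> \<epsilon>}|lebesgue. F t / of_real t)"
    using small
  proof eventually_elim
    case (elim \<epsilon>)
    then have \<epsilon>: "0 < \<epsilon>" "\<epsilon> \<le> 1" by auto
    have bound: "norm ((F t - c) * bht_kernel \<epsilon> t) \<le> 2 * (G t * (\<epsilon> / (t\<^sup>2 + \<epsilon>\<^sup>2)))" for t
      using mult_left_mono[OF norm_bht_kernel_le[OF \<epsilon>(1), of t] G0[of t]]
      by (simp add: norm_mult G_def mult_ac)
    have PI: "integrable lebesgue (\<lambda>t. 2 * (G t * (\<epsilon> / (t\<^sup>2 + \<epsilon>\<^sup>2))))"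
      by (intro integrable_mult_right integrable_mult_poisson[OF G0 Gm Gint \<epsilon>])
    have Kint: "integrable lebesgue (\<lambda>t. (F t - c) * bht_kernel \<epsilon> t)"
      by (rule integrable_dominated[OF PI _ bound]) measurable
    have "norm (K \<epsilon>) \<le> (LINT t|lebesgue. 2 * (G t * (\<epsilon> / (t\<^sup>2 + \<epsilon>\<^sup>2))))"
      unfolding K_def by (rule Bochner_Integration.integral_norm_bound_integral[OF Kint PI]) (rule bound)
    then have 1: "norm (K \<epsilon>) \<le> 2 * (LINT t|lebesgue. G t * (\<epsilon> / (t\<^sup>2 + \<epsilon>\<^sup>2)))"
      unfolding integral_mult_right_zero .
    have dom: "integrable lebesgue (\<lambda>t. 2 / \<epsilon> * (norm (F t) / (1 + \<bar>t\<bar>)))"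
      by (rule integrable_mult_right[OF int])
    \<comment> \<open>Applied below with \<open>s = sqrt (t\<^sup>2 + \<epsilon>\<^sup>2)\<close>
      and with \<open>s = \<bar>t\<bar>\<close>. The premise holds because
      \<open>\<epsilon> \<le> s\<close> and, as \<open>\<epsilon> \<le> 1\<close>, also
      \<open>\<epsilon> * \<bar>t\<bar> \<le> s\<close>.\<close>
    have inv_le: "1 / s \<le> 2 / \<epsilon> * (1 / (1 + \<bar>t\<bar>))" if "\<epsilon> * (1 + \<bar>t\<bar>) \<le> 2 * s" for s t
    proof -
      have "0 < \<epsilon> * (1 + \<bar>t\<bar>)" using \<epsilon> by (intro mult_pos_pos) auto
      then have "1 / s \<le> 1 / (\<epsilon> * (1 + \<bar>t\<bar>) / 2)"
        using that by (intro divide_left_mono mult_pos_pos) auto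
      then show ?thesis by simp
    qed
    have reg: "integrable lebesgue (\<lambda>t. F t / (of_real t + \<i> * of_real \<epsilon>))"
    proof (rule integrable_dominated[OF dom])
      show "norm (F t / (of_real t + \<i> * of_real \<epsilon>)) \<le> 2 / \<epsilon> * (norm (F t) / (1 + \<bar>t\<bar>))" for t
      proof -
        define s where "s = sqrt (t\<^sup>2 + \<epsilon>\<^sup>2)"
        have "\<epsilon> \<le> s" unfolding s_def by (rule real_le_rsqrt) simp
        moreover have "\<bar>t\<bar> \<le> s" unfolding s_def by (rule real_le_rsqrt) simp
        moreover have "\<epsilon> * \<bar>t\<bar> \<le> 1 * \<bar>t\<bar>" using \<epsilon> by (intro mult_right_mono) auto
        ultimately have "\<epsilon> * (1 + \<bar>t\<bar>) \<le> 2 * s" by (simp add: algebra_simps)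
        then have "1 / s \<le> 2 / \<epsilon> * (1 / (1 + \<bar>t\<bar>))"
          by (rule inv_le)
        from mult_left_mono[OF this, of "norm (F t)"] show ?thesis
          by (simp add: norm_divide norm_add_i_mult s_def mult_ac)
      qed
    qed measurable
    have trunc: "integrable lebesgue (\<lambda>t. indicat_real {t. \<bar>t\<bar> \<ge> \<epsilon>} t *\<^sub>R (F t / of_real t))"
    proof (rule integrable_dominated[OF dom])
      show "norm (indicat_real {t. \<bar>t\<bar> \<ge> \<epsilon>} t *\<^sub>R (F t / of_real t))
          \<le> 2 / \<epsilon> * (norm (F t) / (1 + \<bar>t\<bar>))" for t
      proof (cases "\<epsilon> \<le> \<bar>t\<bar>")
        case True
        moreover have "\<epsilon> * \<bar>t\<bar> \<le> 1 * \<bar>t\<bar>" using \<epsilon> by (intro mult_right_mono) auto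
        ultimately have "\<epsilon> * (1 + \<bar>t\<bar>) \<le> 2 * \<bar>t\<bar>" by (simp add: algebra_simps)
        then have "1 / \<bar>t\<bar> \<le> 2 / \<epsilon> * (1 / (1 + \<bar>t\<bar>))"
          by (rule inv_le)
        from mult_left_mono[OF this, of "norm (F t)"] show ?thesis
          using True by (simp add: norm_divide mult_ac)
      qed (use \<epsilon> in simp)
    qed measurable
    have "K \<epsilon> + c * (- \<i> * of_real pi) = K \<epsilon> + (LINT t|lebesgue. c * bht_kernel \<epsilon> t)"
      by (simp add: integral_bht_kernel[OF \<epsilon>(1)])
    also have "\<dots> = (LINT t|lebesgue. (F t - c) * bht_kernel \<epsilon> t + c * bht_kernel \<epsilon> t)"
      unfolding K_def
      by (intro Bochner_Integration.integral_add[symmetric] Kint integrable_mult_right integrable_bht_kernel \<epsilon>)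
    also have "\<dots> = (LINT t|lebesgue. F t / (of_real t + \<i> * of_real \<epsilon>)
        - indicat_real {t. \<bar>t\<bar> \<ge> \<epsilon>} t *\<^sub>R (F t / of_real t))"
      by (intro Bochner_Integration.integral_cong refl)
         (simp add: bht_kernel_def algebra_simps diff_divide_distrib)
    also have "\<dots> = (LINT t|lebesgue. F t / (of_real t + \<i> * of_real \<epsilon>))
        - (LINT t:{t. \<bar>t\<bar> \<ge> \<epsilon>}|lebesgue. F t / of_real t)"
      unfolding set_lebesgue_integral_def by (rule Bochner_Integration.integral_diff[OF reg trunc])
    finally show ?case using 1 by simp
  qed
  have "(K \<longlongrightarrow> 0) (at_right 0)"
  proof (rule Lim_null_comparison)
    show "\<forall>\<^sub>F \<epsilon> in at_right 0. norm (K \<epsilon>) \<le> 2 * (LINT t|lebesgue. G t * (\<epsilon> / (t\<^sup>2 + \<epsilon>\<^sup>2)))"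
      using ev by eventually_elim simp
    show "((\<lambda>\<epsilon>. 2 * (LINT t|lebesgue. G t * (\<epsilon> / (t\<^sup>2 + \<epsilon>\<^sup>2)))) \<longlongrightarrow> 0) (at_right 0)"
      using tendsto_mult_left[OF lim, of 2] by simp
  qed
  then have "((\<lambda>\<epsilon>. K \<epsilon> + c * (- \<i> * of_real pi)) \<longlongrightarrow> 0 + c * (- \<i> * of_real pi)) (at_right 0)"
    by (intro tendsto_intros)
  then show ?thesis
    by (rule Lim_transform_eventually[THEN tendsto_eq_rhs]) (use ev in \<open>auto elim: eventually_mono\<close>)
qed

section \<open>Affine substitutions\<close>

text \<open>On the completed measure, continuity of the inner map does not suffice: preimages of
  null sets must be measurable as well, which \<open>c \<noteq> 0\<close> ensures.\<close>

lemma measurable_affine_lebesgue: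
  fixes a c :: real
  assumes "f \<in> borel_measurable lebesgue" and "c \<noteq> 0"
  shows "(\<lambda>t. f (a + c * t)) \<in> borel_measurable lebesgue"
proof -
  have "(\<lambda>t. a + c * t) \<in> lebesgue \<rightarrow>\<^sub>M lebesgue"
    using lebesgue_affine_measurable[where c = "\<lambda>_::real. c" and t = a] \<open>c \<noteq> 0\<close> by simp
  then show ?thesis by (rule measurable_compose) (rule assms(1))
qed

text \<open>Lebesgue measure is its own image under the map up to the constant density
  \<open>\<bar>c\<bar>\<close>, so null sets pull back to null sets.\<close>

lemma AE_affine_lebesgue:
  fixes a c :: real
  assumes "AE t in lebesgue. P t" and "c \<noteq> 0"
  shows "AE t in lebesgue. P (a + c * t)"
proof -
  have m: "(\<lambda>t. a + c * t) \<in> lebesgue \<rightarrow>\<^sub>M lebesgue"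
    using lebesgue_affine_measurable[where c = "\<lambda>_::real. c" and t = a] \<open>c \<noteq> 0\<close> by simp
  have "AE t in density (distr lebesgue lebesgue (\<lambda>x. a + c * x)) (\<lambda>_. ennreal \<bar>c\<bar>). P t"
    using assms(1) by (subst (asm) lebesgue_real_affine[OF \<open>c \<noteq> 0\<close>, of a])
  then have "AE t in distr lebesgue lebesgue (\<lambda>x. a + c * x). P t"
    using \<open>c \<noteq> 0\<close> by (simp add: AE_density)
  then show ?thesis by (rule AE_distrD[OF m])
qed

text \<open>The average at radius \<open>\<bar>c\<bar> * r\<close> is rewritten by replacing
  \<open>t\<close> with \<open>- c * t\<close>; the Jacobian \<open>\<bar>c\<bar>\<close> cancels
  against the factor \<open>1 / (\<bar>c\<bar> * r)\<close>. It is needed with \<open>c = -1\<close>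
  for \<open>f\<close> and \<open>c = \<alpha>\<close> for \<open>g\<close>.\<close>

lemma Lebesgue_points_affine:
  fixes h :: "real \<Rightarrow> complex"
  assumes "x \<in> Lebesgue_points p h" and "c \<noteq> 0"
  shows "((\<lambda>r. 1 / r * (LINT t:{t. \<bar>t\<bar> < r}|lebesgue. norm (h (x + c * t) - h x) powr p)) \<longlongrightarrow> 0) (at_right 0)"
proof -
  define \<Phi> where "\<Phi> r = 1 / r * (LINT t:{t. \<bar>t\<bar> < r}|lebesgue. norm (h (x - t) - h x) powr p)" for r
  have "filterlim (\<lambda>r. \<bar>c\<bar> * r) (at_right 0) (at_right 0)"
    by (rule filterlim_times_pos[OF filterlim_ident]) (use \<open>c \<noteq> 0\<close> in auto)
  then have "((\<lambda>r. \<Phi> (\<bar>c\<bar> * r)) \<longlongrightarrow> 0) (at_right 0)"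
    by (rule filterlim_compose[rotated]) (use assms(1) in \<open>simp add: Lebesgue_points_def \<Phi>_def\<close>)
  moreover have "\<Phi> (\<bar>c\<bar> * r) = 1 / r * (LINT t:{t. \<bar>t\<bar> < r}|lebesgue. norm (h (x + c * t) - h x) powr p)" for r
  proof -
    let ?k = "\<lambda>t. indicat_real {t. \<bar>t\<bar> < \<bar>c\<bar> * r} t *\<^sub>R norm (h (x - t) - h x) powr p"
    have "(LINT t|lebesgue. ?k t) = \<bar>c\<bar> * (LINT t|lebesgue. ?k (0 + (- c) * t))"
      using lebesgue_integral_real_affine[of "- c" ?k 0] \<open>c \<noteq> 0\<close> by simp
    also have "(\<lambda>t. ?k (0 + (- c) * t)) = (\<lambda>t. indicat_real {t. \<bar>t\<bar> < r} t *\<^sub>R norm (h (x + c * t) - h x) powr p)"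
      using \<open>c \<noteq> 0\<close> by (auto simp: indicator_def abs_mult)
    finally show ?thesis
      using \<open>c \<noteq> 0\<close> by (simp add: \<Phi>_def set_lebesgue_integral_def)
  qed
  ultimately show ?thesis by simp
qed

section \<open>Lebesgue points of a product\<close>

lemma powr_add_le:
  fixes u v p :: real
  assumes "0 \<le> u" "0 \<le> v" "0 \<le> p"
  shows "(u + v) powr p \<le> 2 powr p * (u powr p + v powr p)"
proof -
  have "(u + v) powr p \<le> (2 * max u v) powr p"
    using assms by (intro powr_mono2) auto
  also have "\<dots> = 2 powr p * (max u v) powr p"
    using assms by (simp add: powr_mult)
  also have "\<dots> \<le> 2 powr p * (u powr p + v powr p)"
    by (intro mult_left_mono) (auto simp: max_def)
  finally show ?thesis .
qed

lemma set_integrable_const_abs_less: "set_integrable lebesgue {t. \<bar>t\<bar> < r} (\<lambda>t::real. k::real)"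
proof -
  have "{t. \<bar>t\<bar> < r} = {-r<..<r}" by auto
  then show ?thesis by (simp add: absolutely_integrable_on_const lmeasurable_interval)
qed

lemma set_lebesgue_integral_const_abs_less:
  "0 \<le> r \<Longrightarrow> (LINT t:{t. \<bar>t\<bar> < r}|lebesgue. k) = 2 * r * (k::real)" for r :: real
proof -
  assume "0 \<le> r"
  have "{t. \<bar>t\<bar> < r} = {-r<..<r}" by auto
  then show ?thesis using \<open>0 \<le> r\<close> by (simp add: set_lebesgue_integral_def)
qed

lemma set_integrable_diff_powr:
  fixes u :: "real \<Rightarrow> complex"
  assumes [measurable]: "u \<in> borel_measurable lebesgue" and "integrable lebesgue (\<lambda>t. norm (u t) powr p)" and "0 \<le> p"
  shows "set_integrable lebesgue {t. \<bar>t\<bar> < r} (\<lambda>t. norm (u t - a) powr p)"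
  unfolding set_integrable_def
proof (rule integrable_dominated)
  let ?g = "\<lambda>t. indicat_real {t. \<bar>t\<bar> < r} t *\<^sub>R (2 powr p * (norm (u t) powr p + norm a powr p))"
  have "set_integrable lebesgue {t. \<bar>t\<bar> < r} (\<lambda>t. 2 powr p * (norm (u t) powr p + norm a powr p))"
    by (intro set_integrable_mult_right set_integral_add set_integrable_const_abs_less
        integrable_imp_set_integrable assms) auto
  then show "integrable lebesgue ?g" by (simp add: set_integrable_def)
  show "norm (indicat_real {t. \<bar>t\<bar> < r} t *\<^sub>R norm (u t - a) powr p) \<le> ?g t" for t
  proof -
    have "norm (u t - a) powr p \<le> (norm (u t) + norm a) powr p"
      using \<open>0 \<le> p\<close> by (intro powr_mono2 norm_triangle_ineq4) auto
    also have "\<dots> \<le> 2 powr p * (norm (u t) powr p + norm a powr p)"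
      using \<open>0 \<le> p\<close> by (intro powr_add_le) auto
    finally show ?thesis by (simp add: indicator_def)
  qed
qed measurable

text \<open>Pointwise stand-in for the comparison of power means with exponents
  \<open>b \<le> p\<close>. Values up to \<open>\<eta> powr (1 / b)\<close> contribute at most
  \<open>\<eta>\<close>; for larger ones \<open>v powr (b - p)\<close> is bounded because the
  exponent is not positive. \<open>C\<close> depends on \<open>\<eta>\<close> but not on
  \<open>v\<close>.\<close>

lemma powr_absorb:
  fixes b p \<eta> :: real
  assumes "0 < b" "b \<le> p" "0 < \<eta>"
  obtains C where "0 \<le> C" "\<And>v. 0 \<le> v \<Longrightarrow> v powr b \<le> \<eta> + C * v powr p"
proof (rule that[of "(\<eta> powr (1 / b)) powr (b - p)"])
  fix v :: real
  assume "0 \<le> v"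
  let ?s = "\<eta> powr (1 / b)"
  show "v powr b \<le> \<eta> + ?s powr (b - p) * v powr p"
  proof (cases "v \<le> ?s")
    case True
    then have "v powr b \<le> ?s powr b" using assms \<open>0 \<le> v\<close> by (intro powr_mono2) auto
    also have "\<dots> = \<eta>" using assms by (simp add: powr_powr)
    finally show ?thesis by (simp add: add_increasing2)
  next
    case False
    have "0 < ?s" using assms by simp
    then have "0 < v" using False by linarith
    have "v powr b = v powr (b - p) * v powr p" by (simp add: powr_add[symmetric])
    also have "\<dots> \<le> ?s powr (b - p) * v powr p"
      using False \<open>0 < ?s\<close> assms by (intro mult_right_mono powr_mono2') auto
    finally show ?thesis using assms by simp
  qed
qed simp

lemma mult_le_powr_conjugate:
  fixes p q u v :: real
  assumes "1 < p" "1 < q" "1 / p + 1 / q = 1" "0 \<le> u" "0 \<le> v"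
  shows "u * v \<le> u powr p + v powr q"
proof -
  have "u * v \<le> u powr p / p + v powr q / q" by (rule Youngs_inequality) (use assms in auto)
  also have "\<dots> \<le> u powr p / 1 + v powr q / 1"
    using assms by (intro add_mono divide_left_mono) auto
  finally show ?thesis by simp
qed

text \<open>Lowering \<open>q\<close> to the conjugate of \<open>p\<close> makes Young's inequality
  available. The gap between \<open>s\<close> and \<open>q\<close> is bridged by
  \<open>powr_absorb\<close> near 0 and by \<open>powr_mult_weight_le\<close> at infinity.\<close>

lemma obtain_conjugate_exponent:
  fixes p q :: real
  assumes "1 < p" "1 < q" "1 / p + 1 / q \<le> 1"
  obtains s where "1 < s" "s \<le> q" "1 / p + 1 / s = 1"
proof (rule that[of "p / (p - 1)"])
  show "1 < p / (p - 1)" "1 / p + 1 / (p / (p - 1)) = 1"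
    using assms by (auto simp: field_simps)
  have "q + p \<le> p * q" using assms by (simp add: field_simps)
  then show "p / (p - 1) \<le> q" using assms by (simp add: field_simps)
qed

text \<open>The left side comes from y z - a b = (y - a)(z - b) + a (z - b) + b (y - a), where
  \<open>u\<close> and \<open>v\<close> stand for the norms of \<open>y - a\<close> and
  \<open>z - b\<close>, and \<open>A\<close> and \<open>B\<close> for those of \<open>a\<close> and
  \<open>b\<close>. Each of the three terms leaves at most \<open>\<eta> / 3\<close> outside the
  powers.\<close>

lemma product_oscillation_absorb:
  fixes p q A B \<eta> :: real
  assumes pq: "1 < p" "1 < q" "1 / p + 1 / q \<le> 1" and "0 \<le> A" "0 \<le> B" "0 < \<eta>"
  obtains C where "0 \<le> C"
    "\<And>u v. 0 \<le> u \<Longrightarrow> 0 \<le> v \<Longrightarrow> u * v + A * v + B * u \<le> \<eta> + C * (u powr p + v powr q)"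
proof -
  obtain s where s: "1 < s" "s \<le> q" "1 / p + 1 / s = 1"
    using obtain_conjugate_exponent[OF pq] by blast
  obtain C1 where C1: "0 \<le> C1" "\<And>v. 0 \<le> v \<Longrightarrow> v powr s \<le> \<eta> / 3 + C1 * v powr q"
    using powr_absorb[of s q "\<eta> / 3"] s \<open>0 < \<eta>\<close> by auto
  \<comment> \<open>The \<open>+ 1\<close> keeps the denominator positive when
    \<open>A = 0\<close>.\<close>
  have "0 < \<eta> / (3 * (A + 1))" using assms by simp
  with powr_absorb[of 1 q "\<eta> / (3 * (A + 1))"] pq
  obtain C2 where C2: "0 \<le> C2" "\<And>v. 0 \<le> v \<Longrightarrow> v powr 1 \<le> \<eta> / (3 * (A + 1)) + C2 * v powr q"
    by auto
  have "0 < \<eta> / (3 * (B + 1))" using assms by simp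
  with powr_absorb[of 1 p "\<eta> / (3 * (B + 1))"] pq
  obtain C3 where C3: "0 \<le> C3" "\<And>v. 0 \<le> v \<Longrightarrow> v powr 1 \<le> \<eta> / (3 * (B + 1)) + C3 * v powr p"
    by auto
  have frac: "D * (\<eta> / (3 * (D + 1))) \<le> \<eta> / 3" if "0 \<le> D" for D
    using that \<open>0 < \<eta>\<close> by (simp add: field_simps)
  show thesis
  proof (rule that[of "1 + C1 + A * C2 + B * C3"])
    show "0 \<le> 1 + C1 + A * C2 + B * C3" using C1 C2 C3 assms by simp
    fix u v :: real
    assume uv: "0 \<le> u" "0 \<le> v"
    define U where "U = u powr p"
    define V where "V = v powr q"
    have U: "0 \<le> U" and V: "0 \<le> V" by (simp_all add: U_def V_def)
    have "u * v \<le> U + (\<eta> / 3 + C1 * V)"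
      using mult_le_powr_conjugate[OF pq(1) s(1,3) uv] C1(2)[OF uv(2)] by (simp add: U_def V_def)
    moreover have "A * v \<le> \<eta> / 3 + A * C2 * V"
    proof -
      have "A * v \<le> A * (\<eta> / (3 * (A + 1)) + C2 * V)"
        using C2(2)[OF uv(2)] \<open>0 \<le> A\<close> uv by (intro mult_left_mono) (simp_all add: V_def)
      also have "\<dots> = A * (\<eta> / (3 * (A + 1))) + A * C2 * V"
        by (simp only: distrib_left mult.assoc)
      also have "\<dots> \<le> \<eta> / 3 + A * C2 * V"
        using frac[OF \<open>0 \<le> A\<close>] by (rule add_right_mono)
      finally show ?thesis .
    qed
    moreover have "B * u \<le> \<eta> / 3 + B * C3 * U"
    proof -
      have "B * u \<le> B * (\<eta> / (3 * (B + 1)) + C3 * U)"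
        using C3(2)[OF uv(1)] \<open>0 \<le> B\<close> uv by (intro mult_left_mono) (simp_all add: U_def)
      also have "\<dots> = B * (\<eta> / (3 * (B + 1))) + B * C3 * U"
        by (simp only: distrib_left mult.assoc)
      also have "\<dots> \<le> \<eta> / 3 + B * C3 * U"
        using frac[OF \<open>0 \<le> B\<close>] by (rule add_right_mono)
      finally show ?thesis .
    qed
    moreover have "0 \<le> C1 * U" "0 \<le> A * C2 * U" "0 \<le> B * C3 * V" "0 \<le> V"
      using C1 C2 C3 assms U V by auto
    ultimately show "u * v + A * v + B * u \<le> \<eta> + (1 + C1 + A * C2 + B * C3) * (u powr p + v powr q)"
      unfolding U_def[symmetric] V_def[symmetric] by (simp add: distrib_left distrib_right)
  qed
qed

text \<open>The pointwise bound is integrated over an interval of length \<open>2 * r\<close> and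
  divided by \<open>r\<close>: its constant \<open>e / 4\<close> becomes \<open>e / 2\<close>, and
  the rest is \<open>C\<close> times the two given averages. \<open>C\<close> is chosen before
  \<open>r\<close>, so that part falls below \<open>e / 2\<close>.\<close>

lemma product_Lebesgue_point:
  fixes u v :: "real \<Rightarrow> complex"
  assumes pq: "1 < p" "1 < q" "1 / p + 1 / q \<le> 1"
    and [measurable]: "u \<in> borel_measurable lebesgue" "v \<in> borel_measurable lebesgue"
    and iu: "\<And>r. set_integrable lebesgue {t. \<bar>t\<bar> < r} (\<lambda>t. norm (u t - a) powr p)"
    and iv: "\<And>r. set_integrable lebesgue {t. \<bar>t\<bar> < r} (\<lambda>t. norm (v t - b) powr q)"
    and lu: "((\<lambda>r. 1 / r * (LINT t:{t. \<bar>t\<bar> < r}|lebesgue. norm (u t - a) powr p)) \<longlongrightarrow> 0) (at_right 0)"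
    and lv: "((\<lambda>r. 1 / r * (LINT t:{t. \<bar>t\<bar> < r}|lebesgue. norm (v t - b) powr q)) \<longlongrightarrow> 0) (at_right 0)"
  shows "((\<lambda>r. 1 / r * (LINT t:{t. \<bar>t\<bar> < r}|lebesgue. norm (u t * v t - a * b))) \<longlongrightarrow> 0) (at_right 0)"
proof (rule tendstoI)
  fix e :: real
  assume "e > 0"
  obtain C where C: "0 \<le> C" "\<And>y z. 0 \<le> y \<Longrightarrow> 0 \<le> z \<Longrightarrow>
      y * z + norm a * z + norm b * y \<le> e / 4 + C * (y powr p + z powr q)"
    using product_oscillation_absorb[OF pq, of "norm a" "norm b" "e / 4"] \<open>e > 0\<close> by auto
  define S where "S r = 1 / r * (LINT t:{t. \<bar>t\<bar> < r}|lebesgue. norm (u t - a) powr p)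
      + 1 / r * (LINT t:{t. \<bar>t\<bar> < r}|lebesgue. norm (v t - b) powr q)" for r
  have "((\<lambda>r. C * S r) \<longlongrightarrow> C * (0 + 0)) (at_right 0)"
    unfolding S_def by (intro tendsto_intros lu lv)
  then have "\<forall>\<^sub>F r in at_right 0. C * S r < e / 2"
    using \<open>e > 0\<close> by (intro order_tendstoD) auto
  with eventually_at_right_less[of 0]
  show "\<forall>\<^sub>F r in at_right 0. dist (1 / r * (LINT t:{t. \<bar>t\<bar> < r}|lebesgue. norm (u t * v t - a * b))) 0 < e"
  proof eventually_elim
    case (elim r)
    let ?A = "{t. \<bar>t\<bar> < r}"
    have bound: "norm (u t * v t - a * b) \<le> e / 4 + C * (norm (u t - a) powr p + norm (v t - b) powr q)" for t
    proof -
      have "u t * v t - a * b = (u t - a) * (v t - b) + a * (v t - b) + b * (u t - a)"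
        by (simp add: algebra_simps)
      also have "norm \<dots> \<le> norm ((u t - a) * (v t - b)) + norm (a * (v t - b)) + norm (b * (u t - a))"
        by (intro order_trans[OF norm_triangle_ineq] add_right_mono norm_triangle_ineq)
      also have "\<dots> \<le> e / 4 + C * (norm (u t - a) powr p + norm (v t - b) powr q)"
        unfolding norm_mult by (rule C(2)) auto
      finally show ?thesis .
    qed
    have ib: "set_integrable lebesgue ?A (\<lambda>t. e / 4 + C * (norm (u t - a) powr p + norm (v t - b) powr q))"
      by (intro set_integral_add set_integrable_mult_right set_integrable_const_abs_less iu iv)
    have "set_integrable lebesgue ?A (\<lambda>t. norm (u t * v t - a * b))"
      unfolding set_integrable_def
      by (rule integrable_dominated[OF ib[unfolded set_integrable_def]])
         (measurable, use bound in \<open>simp add: indicator_def\<close>)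
    then have "(LINT t:?A|lebesgue. norm (u t * v t - a * b))
        \<le> (LINT t:?A|lebesgue. e / 4 + C * (norm (u t - a) powr p + norm (v t - b) powr q))"
      by (rule set_integral_mono[OF _ ib]) (rule bound)
    also have "\<dots> = 2 * r * (e / 4) + C * ((LINT t:?A|lebesgue. norm (u t - a) powr p)
        + (LINT t:?A|lebesgue. norm (v t - b) powr q))"
      using elim by (simp add: set_integral_add set_integrable_mult_right set_integrable_const_abs_less
          iu iv set_lebesgue_integral_const_abs_less)
    finally have "1 / r * (LINT t:?A|lebesgue. norm (u t * v t - a * b)) \<le> e / 2 + C * S r"
      using elim by (simp add: S_def field_simps)
    also have "\<dots> < e" using elim by simp
    finally have "1 / r * (LINT t:?A|lebesgue. norm (u t * v t - a * b)) < e" .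
    moreover have "0 \<le> 1 / r * (LINT t:?A|lebesgue. norm (u t * v t - a * b))"
      using elim by (intro mult_nonneg_nonneg) (auto simp: set_lebesgue_integral_def intro!: Bochner_Integration.integral_nonneg)
    ultimately show ?case unfolding dist_real_def by linarith
  qed
qed

section \<open>Integrability at infinity\<close>

lemma integrable_1_plus_abs_powr:
  fixes s :: real
  assumes "1 < s"
  shows "integrable lebesgue (\<lambda>t. (1 / (1 + \<bar>t\<bar>)) powr s)"
proof -
  define k where "k = (\<lambda>t. indicat_real {1..} t *\<^sub>R t powr (- s))"
  have "(\<lambda>t. t powr (- s)) absolutely_integrable_on {1..}"
    using has_integral_powr_to_inf[of "- s" 1] assms
    by (intro nonnegative_absolutely_integrable_1) (auto simp: integrable_on_def)
  then have k: "integrable lebesgue k"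
    by (simp only: set_integrable_def k_def)
  \<comment> \<open>The two shifted copies of the power tail on \<open>{1..}\<close> cover the
    half-lines \<open>t \<ge> 0\<close> and \<open>t \<le> 0\<close>.\<close>
  have "integrable lebesgue (\<lambda>t. k (1 + 1 * t) + k (1 + (-1) * t))"
    by (intro Bochner_Integration.integrable_add lebesgue_integrable_real_affine k) auto
  then show ?thesis
  proof (rule integrable_dominated)
    show "(\<lambda>t. (1 / (1 + \<bar>t\<bar>)) powr s) \<in> borel_measurable lebesgue"
      by measurable
    show "norm ((1 / (1 + \<bar>t\<bar>)) powr s) \<le> k (1 + 1 * t) + k (1 + (-1) * t)" for t
      by (cases "0 \<le> t") (auto simp: k_def powr_minus_divide powr_divide indicator_def)
  qed
qed

text \<open>Global counterpart of \<open>powr_absorb\<close>, with \<open>w powr s\<close> in place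
  of the constant. For \<open>v \<le> 1\<close> the product is at most \<open>w\<close>; for
  \<open>v > 1\<close> it is at most \<open>v\<close>, and raising the exponent from
  \<open>s\<close> to \<open>q\<close> only enlarges the power.\<close>

lemma powr_mult_weight_le:
  fixes v w q s :: real
  assumes "0 \<le> v" "0 \<le> w" "w \<le> 1" "0 < s" "s \<le> q"
  shows "(v * w) powr s \<le> v powr q + w powr s"
proof (cases "v \<le> 1")
  case True
  then have "(v * w) powr s \<le> w powr s"
    using assms by (intro powr_mono2) (auto intro: mult_left_le_one_le)
  then show ?thesis by (simp add: add_increasing)
next
  case False
  then have "(v * w) powr s \<le> v powr s"
    using assms by (intro powr_mono2) (auto intro: mult_right_le_one_le)
  also have "\<dots> \<le> v powr q" using False assms by (intro powr_mono) auto
  finally show ?thesis by (simp add: add_increasing2)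
qed

text \<open>The weight is attached to \<open>v\<close> before Young's inequality is applied with
  \<open>p\<close> and \<open>s\<close>; since \<open>s > 1\<close>, the term
  \<open>(1 / (1 + \<bar>t\<bar>)) powr s\<close> that appears is integrable.\<close>

lemma integrable_weighted_product:
  fixes u v :: "real \<Rightarrow> complex"
  assumes pq: "1 < p" "1 < q" "1 / p + 1 / q \<le> 1"
    and [measurable]: "u \<in> borel_measurable lebesgue" "v \<in> borel_measurable lebesgue"
    and "integrable lebesgue (\<lambda>t. norm (u t) powr p)" "integrable lebesgue (\<lambda>t. norm (v t) powr q)"
  shows "integrable lebesgue (\<lambda>t. norm (u t * v t) / (1 + \<bar>t\<bar>))"
proof -
  obtain s where s: "1 < s" "s \<le> q" "1 / p + 1 / s = 1"
    using obtain_conjugate_exponent[OF pq] by blast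
  have "integrable lebesgue (\<lambda>t. norm (u t) powr p + (norm (v t) powr q + (1 / (1 + \<bar>t\<bar>)) powr s))"
    by (intro Bochner_Integration.integrable_add assms integrable_1_plus_abs_powr s)
  then show ?thesis
  proof (rule integrable_dominated)
    fix t :: real
    define w where "w = 1 / (1 + \<bar>t\<bar>)"
    have "norm (norm (u t * v t) / (1 + \<bar>t\<bar>)) = norm (u t) * (norm (v t) * w)"
      by (simp add: w_def norm_mult)
    also have "\<dots> \<le> norm (u t) powr p + (norm (v t) * w) powr s"
      using pq(1) s(1,3) by (rule mult_le_powr_conjugate) (auto simp: w_def)
    also have "(norm (v t) * w) powr s \<le> norm (v t) powr q + w powr s"
      using s by (intro powr_mult_weight_le) (auto simp: w_def)
    finally show "norm (norm (u t * v t) / (1 + \<bar>t\<bar>))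
        \<le> norm (u t) powr p + (norm (v t) powr q + (1 / (1 + \<bar>t\<bar>)) powr s)"
      by (simp add: w_def)
  qed measurable
qed

lemma integrable_weighted_product_bounded:
  fixes u v :: "real \<Rightarrow> complex"
  assumes [measurable]: "u \<in> borel_measurable lebesgue" "v \<in> borel_measurable lebesgue"
    and "integrable lebesgue (\<lambda>t. norm (u t) powr 2)" and M: "AE t in lebesgue. norm (v t) \<le> M"
  shows "integrable lebesgue (\<lambda>t. norm (u t * v t) / (1 + \<bar>t\<bar>))"
proof -
  have "integrable lebesgue (\<lambda>t. \<bar>M\<bar> * (norm (u t) powr 2 + (1 / (1 + \<bar>t\<bar>)) powr 2))"
    by (intro Bochner_Integration.integrable_add integrable_mult_right assms integrable_1_plus_abs_powr) auto
  then show ?thesis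
  proof (rule Bochner_Integration.integrable_bound)
    show "AE t in lebesgue. norm (norm (u t * v t) / (1 + \<bar>t\<bar>))
        \<le> norm (\<bar>M\<bar> * (norm (u t) powr 2 + (1 / (1 + \<bar>t\<bar>)) powr 2))"
      using M
    proof eventually_elim
      case (elim t)
      define w where "w = 1 / (1 + \<bar>t\<bar>)"
      have "0 \<le> w" by (simp add: w_def)
      have "norm (norm (u t * v t) / (1 + \<bar>t\<bar>)) = norm (v t) * (norm (u t) * w)"
        by (simp add: w_def norm_mult)
      also have "\<dots> \<le> \<bar>M\<bar> * (norm (u t) powr 2 + w powr 2)"
        using elim \<open>0 \<le> w\<close> by (intro mult_mono mult_le_powr_conjugate) auto
      also have "\<dots> \<le> norm (\<bar>M\<bar> * (norm (u t) powr 2 + w powr 2))" by simp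
      finally show ?case by (simp add: w_def)
    qed
  qed measurable
qed

section \<open>The essentially bounded factor\<close>

lemma Linf_space_AE_bounded:
  assumes "g \<in> Linf_space"
  obtains M where "AE t in lebesgue. norm (g t) \<le> M"
proof -
  let ?e = "esssup lebesgue (\<lambda>x. ereal (norm (g x)))"
  have AE: "AE x in lebesgue. ereal (norm (g x)) \<le> ?e" by (rule esssup_AE)
  have "?e < \<infinity>" using assms by (simp add: Linf_space_def)
  then obtain M where M: "?e \<le> ereal M" by (cases ?e) auto
  have "AE x in lebesgue. norm (g x) \<le> M"
    using AE by eventually_elim (use M in \<open>auto dest: order_trans\<close>)
  then show thesis by (rule that)
qed

text \<open>Reduces the local part of the bounded case to finite exponents. An essential bound
  \<open>\<eta>\<close> on an interval of length \<open>2 * r\<close> makes the average at most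
  \<open>2 * \<eta> powr p\<close>, which is \<open>e / 2\<close> for the chosen
  \<open>\<eta>\<close>.\<close>

lemma Lebesgue_points_inf_imp_Lebesgue_points:
  assumes "x \<in> Lebesgue_points_inf g" and "0 < p"
  shows "x \<in> Lebesgue_points p g"
  unfolding Lebesgue_points_def mem_Collect_eq
proof (rule tendstoI)
  fix e :: real
  assume "e > 0"
  define \<eta> where "\<eta> = (e / 4) powr (1 / p)"
  have \<eta>: "0 < \<eta>" "\<eta> powr p = e / 4" using \<open>e > 0\<close> \<open>0 < p\<close> by (auto simp: \<eta>_def powr_powr)
  have "\<forall>\<^sub>F r in at_right 0. esssup (lebesgue_on {t. \<bar>t\<bar> < r}) (\<lambda>t. ereal (norm (g (x - t) - g x))) < ereal \<eta>"
    using assms \<eta> by (intro order_tendstoD) (auto simp: Lebesgue_points_inf_def)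
  with eventually_at_right_less[of 0]
  show "\<forall>\<^sub>F r in at_right 0. dist (1 / r * (LINT t:{t. \<bar>t\<bar> < r}|lebesgue. norm (g (x - t) - g x) powr p)) 0 < e"
  proof eventually_elim
    case (elim r)
    let ?A = "{t. \<bar>t\<bar> < r}"
    have "AE t in lebesgue_on ?A. ereal (norm (g (x - t) - g x))
        \<le> esssup (lebesgue_on ?A) (\<lambda>t. ereal (norm (g (x - t) - g x)))"
      by (rule esssup_AE)
    then have "AE t in lebesgue_on ?A. norm (g (x - t) - g x) \<le> \<eta>"
      by eventually_elim (use elim in \<open>auto dest: le_less_trans less_imp_le\<close>)
    then have "AE t in lebesgue. t \<in> ?A \<longrightarrow> norm (g (x - t) - g x) \<le> \<eta>"
      by (subst (asm) AE_restrict_space_iff) auto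
    then have "AE t in lebesgue. indicat_real ?A t *\<^sub>R norm (g (x - t) - g x) powr p \<le> indicat_real ?A t *\<^sub>R (\<eta> powr p)"
      by eventually_elim (use \<open>0 < p\<close> in \<open>auto simp: indicator_def intro!: powr_mono2\<close>)
    \<comment> \<open>\<open>integral_mono_AE'\<close> asks for integrability of the nonnegative
      upper bound only: a left side that is not integrable would have integral 0.\<close>
    then have "(LINT t:?A|lebesgue. norm (g (x - t) - g x) powr p) \<le> (LINT t:?A|lebesgue. \<eta> powr p)"
      unfolding set_lebesgue_integral_def
      by (intro integral_mono_AE' set_integrable_const_abs_less[unfolded set_integrable_def]) auto
    also have "\<dots> = r * (e / 2)"
      using elim \<eta> by (simp add: set_lebesgue_integral_const_abs_less)
    finally have "1 / r * (LINT t:?A|lebesgue. norm (g (x - t) - g x) powr p) \<le> e / 2"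
      using elim by (simp add: field_simps)
    moreover have "0 \<le> 1 / r * (LINT t:?A|lebesgue. norm (g (x - t) - g x) powr p)"
      using elim by (intro mult_nonneg_nonneg) (auto simp: set_lebesgue_integral_def intro!: Bochner_Integration.integral_nonneg)
    ultimately show ?case using \<open>e > 0\<close> unfolding dist_real_def by linarith
  qed
qed

lemma set_integrable_bounded_diff_powr:
  fixes v :: "real \<Rightarrow> complex"
  assumes [measurable]: "v \<in> borel_measurable lebesgue" and M: "AE t in lebesgue. norm (v t) \<le> M" and "0 \<le> q"
  shows "set_integrable lebesgue {t. \<bar>t\<bar> < r} (\<lambda>t. norm (v t - b) powr q)"
  unfolding set_integrable_def
proof (rule Bochner_Integration.integrable_bound[OF
      set_integrable_const_abs_less[unfolded set_integrable_def, of r "(M + norm b) powr q"]])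
  show "AE t in lebesgue. norm (indicat_real {t. \<bar>t\<bar> < r} t *\<^sub>R norm (v t - b) powr q)
      \<le> norm (indicat_real {t. \<bar>t\<bar> < r} t *\<^sub>R (M + norm b) powr q)"
    using M
  proof eventually_elim
    case (elim t)
    have "norm (v t - b) \<le> M + norm b" using norm_triangle_ineq4[of "v t" b] elim by linarith
    then have "norm (v t - b) powr q \<le> (M + norm b) powr q" using \<open>0 \<le> q\<close> by (intro powr_mono2) auto
    then show ?case by (simp add: indicator_def)
  qed
qed measurable

section \<open>Application to \<open>f (x - t)\<close> and
  \<open>g (x + \<alpha> * t)\<close>\<close>

theorem theorem1p1:
  fixes \<alpha> x :: real and f g :: "real \<Rightarrow> complex"
  assumes "\<alpha> \<noteq> 0" and "\<alpha> \<noteq> -1"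
    and "(f \<in> Lp_space 2 \<and> g \<in> Linf_space \<and> x \<in> Lebesgue_points 2 f \<inter> Lebesgue_points_inf g) \<or>
         (\<exists>p1 p2. 1 < p1 \<and> 1 < p2 \<and> 1 / p1 + 1 / p2 \<le> 1 \<and>
            f \<in> Lp_space p1 \<and> g \<in> Lp_space p2 \<and>
            x \<in> Lebesgue_points p1 f \<inter> Lebesgue_points p2 g)"
    and "bht_exists \<alpha> f g x"
  shows "\<exists>L. ((\<lambda>\<epsilon>. bht_reg \<alpha> \<epsilon> f g x) \<longlongrightarrow> L) (at_right 0) \<and>
           f x * g x = \<i> / of_real pi * (L - bht \<alpha> f g x)"
proof -
  \<comment> \<open>Written with \<open>(-1) * t\<close> so that the affine substitution lemmas
    apply to \<open>u\<close> and \<open>v\<close> alike.\<close>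
  define u where "u t = f (x + (-1) * t)" for t
  define v where "v t = g (x + \<alpha> * t)" for t
  have fm: "f \<in> borel_measurable lebesgue" and gm: "g \<in> borel_measurable lebesgue"
    using assms(3) by (auto simp: Lp_space_def Linf_space_def)
  have um[measurable]: "u \<in> borel_measurable lebesgue" unfolding u_def
    by (rule measurable_affine_lebesgue[OF fm]) simp
  have vm[measurable]: "v \<in> borel_measurable lebesgue" unfolding v_def
    by (rule measurable_affine_lebesgue[OF gm \<open>\<alpha> \<noteq> 0\<close>])
  have Lp_affine: "integrable lebesgue (\<lambda>t. norm (h (x + c * t)) powr p)"
    if "h \<in> Lp_space p" "c \<noteq> 0" for h c p
    using lebesgue_integrable_real_affine[of "\<lambda>t. norm (h t) powr p" c x] that by (simp add: Lp_space_def)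
  have "integrable lebesgue (\<lambda>t. norm (u t * v t) / (1 + \<bar>t\<bar>)) \<and>
    ((\<lambda>r. 1 / r * (LINT t:{t. \<bar>t\<bar> < r}|lebesgue. norm (u t * v t - f x * g x))) \<longlongrightarrow> 0) (at_right 0)"
    using assms(3)
  proof (elim disjE conjE exE)
    assume f: "f \<in> Lp_space 2" and g: "g \<in> Linf_space" and x: "x \<in> Lebesgue_points 2 f \<inter> Lebesgue_points_inf g"
    obtain M where "AE t in lebesgue. norm (g t) \<le> M"
      using Linf_space_AE_bounded[OF g] .
    then have M: "AE t in lebesgue. norm (v t) \<le> M"
      unfolding v_def by (rule AE_affine_lebesgue[OF _ \<open>\<alpha> \<noteq> 0\<close>])
    have fi: "integrable lebesgue (\<lambda>t. norm (u t) powr 2)"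
      unfolding u_def by (rule Lp_affine[OF f]) simp
    \<comment> \<open>Near \<open>x\<close> this case becomes the exponent pair
      \<open>(2, 2)\<close>. At infinity \<open>g\<close> need not be square integrable, so the
      weighted integrability uses its essential bound instead.\<close>
    have g2: "x \<in> Lebesgue_points 2 g"
      using x by (intro Lebesgue_points_inf_imp_Lebesgue_points) auto
    show ?thesis
    proof (intro conjI integrable_weighted_product_bounded[OF um vm fi M]
        product_Lebesgue_point[of 2 2, OF _ _ _ um vm])
      show "((\<lambda>r. 1 / r * (LINT t:{t. \<bar>t\<bar> < r}|lebesgue. norm (u t - f x) powr 2)) \<longlongrightarrow> 0) (at_right 0)"
        unfolding u_def using x by (intro Lebesgue_points_affine) auto
      show "((\<lambda>r. 1 / r * (LINT t:{t. \<bar>t\<bar> < r}|lebesgue. norm (v t - g x) powr 2)) \<longlongrightarrow> 0) (at_right 0)"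
        unfolding v_def by (rule Lebesgue_points_affine[OF g2 \<open>\<alpha> \<noteq> 0\<close>])
      show "set_integrable lebesgue {t. \<bar>t\<bar> < r} (\<lambda>t. norm (u t - f x) powr 2)" for r
        by (rule set_integrable_diff_powr[OF um fi]) simp
      show "set_integrable lebesgue {t. \<bar>t\<bar> < r} (\<lambda>t. norm (v t - g x) powr 2)" for r
        by (rule set_integrable_bounded_diff_powr[OF vm M]) simp
    qed simp_all
  next
    fix p q
    assume pq: "1 < p" "1 < q" "1 / p + 1 / q \<le> 1" and f: "f \<in> Lp_space p" and g: "g \<in> Lp_space q"
      and x: "x \<in> Lebesgue_points p f \<inter> Lebesgue_points q g"
    have fi: "integrable lebesgue (\<lambda>t. norm (u t) powr p)"
      unfolding u_def by (rule Lp_affine[OF f]) simp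
    have gi: "integrable lebesgue (\<lambda>t. norm (v t) powr q)"
      unfolding v_def by (rule Lp_affine[OF g \<open>\<alpha> \<noteq> 0\<close>])
    show ?thesis
    proof (intro conjI integrable_weighted_product[OF pq um vm fi gi] product_Lebesgue_point[OF pq um vm])
      show "((\<lambda>r. 1 / r * (LINT t:{t. \<bar>t\<bar> < r}|lebesgue. norm (u t - f x) powr p)) \<longlongrightarrow> 0) (at_right 0)"
        unfolding u_def using x by (intro Lebesgue_points_affine) auto
      show "((\<lambda>r. 1 / r * (LINT t:{t. \<bar>t\<bar> < r}|lebesgue. norm (v t - g x) powr q)) \<longlongrightarrow> 0) (at_right 0)"
        unfolding v_def using x \<open>\<alpha> \<noteq> 0\<close> by (intro Lebesgue_points_affine) auto
    qed (use pq in \<open>auto intro!: set_integrable_diff_powr fi gi\<close>)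
  qed
  then have "((\<lambda>\<epsilon>. (LINT t|lebesgue. u t * v t / (of_real t + \<i> * of_real \<epsilon>))
            - (LINT t:{t. \<bar>t\<bar> \<ge> \<epsilon>}|lebesgue. u t * v t / of_real t)) \<longlongrightarrow> - \<i> * of_real pi * (f x * g x)) (at_right 0)"
    by (intro bht_reg_diff_trunc_tendsto) auto
  then have diff: "((\<lambda>\<epsilon>. bht_reg \<alpha> \<epsilon> f g x - bht_trunc \<alpha> f g x \<epsilon>) \<longlongrightarrow> - \<i> * of_real pi * (f x * g x)) (at_right 0)"
    by (simp add: bht_reg_def bht_trunc_def u_def v_def)
  \<comment> \<open>Existence of the principal value makes \<open>Lim\<close> the actual limit;
    adding it to the limit of the difference yields convergence of the regularised integrals and the
    value of \<open>L\<close>.\<close>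
  have "(bht_trunc \<alpha> f g x \<longlongrightarrow> bht \<alpha> f g x) (at_right 0)"
    using assms(4) unfolding bht_exists_def bht_def by (auto simp: tendsto_Lim)
  from tendsto_add[OF diff this]
  have "((\<lambda>\<epsilon>. bht_reg \<alpha> \<epsilon> f g x) \<longlongrightarrow> - \<i> * of_real pi * (f x * g x) + bht \<alpha> f g x) (at_right 0)"
    by simp
  moreover have "f x * g x = \<i> / of_real pi * ((- \<i> * of_real pi * (f x * g x) + bht \<alpha> f g x) - bht \<alpha> f g x)"
    by simp
  ultimately show ?thesis by blast
qed

end
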